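(* Let $k\in\mathbb N$ and let $G$ be a finite simple graph containing no odd cut of size at most $k+1$. Let $e_1,\dots,e_{k+1}$ be $k+1$ edges of $G$, and let $H$ be a circuit in $G$ containing $e_1,\dots,e_k$ such that $e_{k+1}$ is a bridge of the graph $G-E(H)$. Then there exists a circuit $H'$ in $G$ containing $e_1,\dots,e_{k+1}$. Moreover, if an end vertex of $e_{k+1}$ is not in $V(H)$, then $H'$ may be chosen so that it passes through that end vertex exactly once.
   Context: A trail is a walk with no repeated edges; a circuit is a closed trail (it may repeat vertices but not edges); $V(H)$ and $E(H)$ denote the vertex and edge set of the subgraph traversed by $H$. For $A\subseteq V(G)$, $\partial_G A=\{uv\in E(G):u\in A,v\notin A\}$; a cut is a set of the form $\partial_G A$, and it is odd if it has odd cardinality. A bridge of a graph is an edge whose deletion increases the number of components. *)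

theory Defs
  imports Main
begin

text \<open>A simple graph is given by its vertex set \<open>V\<close> and its edge set \<open>E\<close>, an edge being the
  two-element set of its ends. A walk is given by its list of vertices, which in a simple graph
  determines the edges traversed.\<close>

definition finite_simple_graph :: "'a set \<Rightarrow> 'a set set \<Rightarrow> bool" where
  "finite_simple_graph V E \<longleftrightarrow>
     finite V \<and> (\<forall>e\<in>E. \<exists>u\<in>V. \<exists>v\<in>V. u \<noteq> v \<and> e = {u, v})"

fun walk_edges :: "'a list \<Rightarrow> 'a set list" where
  "walk_edges [] = []"
| "walk_edges [x] = []"
| "walk_edges (x # y # xs) = {x, y} # walk_edges (y # xs)"

definition walk :: "'a set \<Rightarrow> 'a set set \<Rightarrow> 'a list \<Rightarrow> bool" where
  "walk V E xs \<longleftrightarrow> xs \<noteq> [] \<and> set xs \<subseteq> V \<and> set (walk_edges xs) \<subseteq> E"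

definition trail :: "'a set \<Rightarrow> 'a set set \<Rightarrow> 'a list \<Rightarrow> bool" where
  "trail V E xs \<longleftrightarrow> walk V E xs \<and> distinct (walk_edges xs)"

definition circuit :: "'a set \<Rightarrow> 'a set set \<Rightarrow> 'a list \<Rightarrow> bool" where
  "circuit V E xs \<longleftrightarrow> trail V E xs \<and> hd xs = last xs"

abbreviation verts_of :: "'a list \<Rightarrow> 'a set" where
  "verts_of xs \<equiv> set xs"

abbreviation edges_of :: "'a list \<Rightarrow> 'a set set" where
  "edges_of xs \<equiv> set (walk_edges xs)"

text \<open>The last vertex of a circuit repeats the first one, so it is dropped when counting how often
  the circuit passes through a vertex.\<close>

definition passes_exactly_once :: "'a list \<Rightarrow> 'a \<Rightarrow> bool" where
  "passes_exactly_once xs v \<longleftrightarrow> count_list (butlast xs) v = 1"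

definition edge_boundary :: "'a set set \<Rightarrow> 'a set \<Rightarrow> 'a set set" where
  "edge_boundary E A = {e \<in> E. \<exists>u v. e = {u, v} \<and> u \<in> A \<and> v \<notin> A}"

definition is_cut :: "'a set \<Rightarrow> 'a set set \<Rightarrow> 'a set set \<Rightarrow> bool" where
  "is_cut V E C \<longleftrightarrow> (\<exists>A\<subseteq>V. C = edge_boundary E A)"

definition odd_cut :: "'a set \<Rightarrow> 'a set set \<Rightarrow> 'a set set \<Rightarrow> bool" where
  "odd_cut V E C \<longleftrightarrow> is_cut V E C \<and> odd (card C)"

definition reachable :: "'a set \<Rightarrow> 'a set set \<Rightarrow> 'a \<Rightarrow> 'a \<Rightarrow> bool" where
  "reachable V E u v \<longleftrightarrow> (\<exists>xs. walk V E xs \<and> hd xs = u \<and> last xs = v)"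

definition components :: "'a set \<Rightarrow> 'a set set \<Rightarrow> 'a set set" where
  "components V E = (\<lambda>u. {v. reachable V E u v}) ` V"

definition bridge :: "'a set \<Rightarrow> 'a set set \<Rightarrow> 'a set \<Rightarrow> bool" where
  "bridge V E e \<longleftrightarrow> e \<in> E \<and> card (components V (E - {e})) > card (components V E)"

end

theory Submission
  imports Defs "HOL-Library.Sublist"
begin

text \<open>Let \<open>R\<close> be \<open>G - E(H)\<close> without the bridge \<open>xy\<close>, and cut \<open>H\<close> at the given edges into \<open>F\<close>-free
  segments. Starting from the component of \<open>x\<close> in \<open>R\<close>, repeatedly add all components of \<open>R\<close> that
  meet a segment between two vertices reached before; do the same from \<open>y\<close>. Both closures meet
  every segment in an interval, so \<open>H\<close> leaves each of them at most once per segment. If no segment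
  met both closures, one of them would be left at most \<open>k/2\<close> times and so would have an odd
  boundary of size at most \<open>k + 1\<close>.

  Hence some segment contains vertices of both closures. Choose two such vertices with minimal sum
  of the stages at which they were reached, and remove the stretch between them from \<open>H\<close>. This
  leaves a trail through all edges of \<open>F\<close>. A Posa-type rotation, through the component of an end
  vertex, lowers the stage of that end vertex. Minimality ensures that rotations destroy none of the
  stretches needed later. When both stages are zero, the trail runs from the component of \<open>x\<close>
  to that of \<open>y\<close>, and is closed up by simple paths in these components and the edge \<open>xy\<close>.\<close>

section \<open>Walks as vertex lists\<close>

lemma walk_edges_append:
  "xs \<noteq> [] \<Longrightarrow> ys \<noteq> [] \<Longrightarrow>
    walk_edges (xs @ ys) = walk_edges xs @ {last xs, hd ys} # walk_edges ys"
proof (induction xs rule: walk_edges.induct)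
  case (2 x)
  then show ?case by (cases ys) auto
qed auto

lemma walk_edges_join:
  assumes "xs \<noteq> []" "ys \<noteq> []" "last xs = hd ys"
  shows "walk_edges (xs @ tl ys) = walk_edges xs @ walk_edges ys"
proof (cases "tl ys = []")
  case True
  then show ?thesis using assms by (cases ys) auto
next
  case False
  then obtain y z zs where "ys = y # z # zs" using assms(2) by (metis list.exhaust_sel)
  then show ?thesis using assms by (simp add: walk_edges_append)
qed

lemma walk_edges_rev: "walk_edges (rev xs) = rev (walk_edges xs)"
proof (induction xs rule: walk_edges.induct)
  case (3 x y xs)
  have "walk_edges (rev (y # xs) @ [x]) = walk_edges (rev (y # xs)) @ [{y, x}]"
    by (subst walk_edges_append) (auto simp: last_rev)
  then show ?case using 3 by (auto simp: insert_commute)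
qed auto

lemma length_walk_edges: "length (walk_edges xs) = length xs - 1"
  by (induction xs rule: walk_edges.induct) auto

lemma nth_walk_edges:
  "Suc i < length xs \<Longrightarrow> walk_edges xs ! i = {xs ! i, xs ! Suc i}"
proof (induction xs arbitrary: i rule: walk_edges.induct)
  case (3 x y xs)
  then show ?case by (cases i) auto
qed auto

lemma edges_of_append_subset:
  "edges_of xs \<subseteq> edges_of (xs @ ys)" "edges_of ys \<subseteq> edges_of (xs @ ys)"
  by (cases "xs = []"; cases "ys = []"; auto simp: walk_edges_append)+

lemma edges_of_sublist: "sublist s xs \<Longrightarrow> edges_of s \<subseteq> edges_of xs"
  unfolding sublist_def using edges_of_append_subset by (metis order_trans)

lemma edge_subset_verts: "g \<in> edges_of xs \<Longrightarrow> g \<subseteq> set xs"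
  by (induction xs rule: walk_edges.induct) auto

lemma distinct_walk_edges: "distinct xs \<Longrightarrow> distinct (walk_edges xs)"
proof (induction xs rule: walk_edges.induct)
  case (3 x y xs)
  then show ?case using edge_subset_verts[of "{x, y}" "y # xs"] by auto
qed auto

lemma walk_sublist: "walk V E xs \<Longrightarrow> sublist s xs \<Longrightarrow> s \<noteq> [] \<Longrightarrow> walk V E s"
  unfolding walk_def using edges_of_sublist set_mono_sublist by blast

lemma walk_rev: "walk V E (rev xs) \<longleftrightarrow> walk V E xs"
  by (simp add: walk_def walk_edges_rev)

lemma walk_join:
  assumes "walk V E xs" "walk V E ys" "last xs = hd ys"
  shows "walk V E (xs @ tl ys)" "hd (xs @ tl ys) = hd xs" "last (xs @ tl ys) = last ys"
proof -
  have "set (tl ys) \<subseteq> set ys" by (cases ys) auto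
  then show "walk V E (xs @ tl ys)"
    using assms by (auto simp: walk_def walk_edges_join dest: list.set_sel(2))
  show "hd (xs @ tl ys) = hd xs" using assms by (simp add: walk_def)
  show "last (xs @ tl ys) = last ys"
    using assms by (cases ys) (auto simp: walk_def)
qed

text \<open>A contiguous block that meets \<open>U\<close> without containing it must begin or end
  inside \<open>U\<close>. This decides below which segments survive when the stretch
  \<open>U\<close> is removed from a trail.\<close>

lemma sublist_avoiding:
  assumes "sublist s (X @ U @ Y)" "s \<noteq> []" "hd s \<notin> set U" "last s \<notin> set U"
  shows "sublist s X \<or> sublist s Y \<or> set U \<subseteq> set s"
proof -
  consider "sublist s X" | "sublist s U" | "sublist s Y"
    | s1 s2 where "s = s1 @ s2" "suffix s1 U" "prefix s2 Y"
    | s1 s2 where "s = s1 @ s2" "suffix s1 X" "prefix s2 (U @ Y)"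
    using assms(1) unfolding sublist_append by blast
  then show ?thesis
  proof cases
    case 2
    then show ?thesis using assms(2,3) set_mono_sublist hd_in_set by blast
  next
    case 4
    then show ?thesis using assms(2,3) set_mono_suffix[OF 4(2)] by (cases s1) auto
  next
    case 5
    show ?thesis
    proof (cases "prefix s2 U")
      case True
      have "s2 = []"
      proof (rule ccontr)
        assume "s2 \<noteq> []"
        then have "last s \<in> set s2" using 5(1) by simp
        then show False using True assms(4) set_mono_prefix by blast
      qed
      then show ?thesis using 5 by simp
    next
      case False
      then show ?thesis using 5 by (auto simp: prefix_append)
    qed
  qed auto
qed

section \<open>Reachability\<close>

lemma reachable_refl: "u \<in> V \<Longrightarrow> reachable V E u u"
  unfolding reachable_def by (rule exI[of _ "[u]"]) (auto simp: walk_def)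

lemma reachable_sym: "reachable V E u v \<Longrightarrow> reachable V E v u"
  unfolding reachable_def by (metis walk_rev hd_rev last_rev)

lemma reachable_trans: "reachable V E u v \<Longrightarrow> reachable V E v w \<Longrightarrow> reachable V E u w"
  unfolding reachable_def by (metis walk_join)

lemma reachable_in: "reachable V E u v \<Longrightarrow> u \<in> V \<and> v \<in> V"
  unfolding reachable_def walk_def by (metis hd_in_set last_in_set subsetD)

lemma reachable_edge: "{u, v} \<in> E \<Longrightarrow> u \<in> V \<Longrightarrow> v \<in> V \<Longrightarrow> reachable V E u v"
  unfolding reachable_def by (rule exI[of _ "[u, v]"]) (auto simp: walk_def)

lemma reachable_mono: "reachable V E u v \<Longrightarrow> E \<subseteq> E' \<Longrightarrow> reachable V E' u v"
  unfolding reachable_def walk_def by blast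

lemma walk_reachable:
  assumes "walk V E xs" "v \<in> set xs"
  shows "reachable V E (hd xs) v"
proof -
  obtain ys zs where xs: "xs = (ys @ [v]) @ zs" using assms(2) by (metis append.assoc append_Cons append_Nil split_list)
  then have "walk V E (ys @ [v])" using walk_sublist[OF assms(1), of "ys @ [v]"] by simp
  moreover have "hd (ys @ [v]) = hd xs" using xs by (cases ys) auto
  ultimately show ?thesis unfolding reachable_def by (metis last_snoc)
qed

lemma reachable_simple_path:
  assumes "reachable V E u v"
  obtains P where "walk V E P" "hd P = u" "last P = v" "distinct P"
proof -
  have "\<exists>P. walk V E P \<and> hd P = u \<and> last P = v \<and> distinct P" if "walk V E xs" "hd xs = u" "last xs = v" for xs
    using that
  proof (induction xs rule: length_induct)
    case (1 xs)
    show ?case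
    proof (cases "distinct xs")
      case False
      then obtain as z bs cs where xs: "xs = as @ [z] @ bs @ [z] @ cs" using not_distinct_decomp by blast
      \<comment> \<open>The closed part between two visits to \<open>z\<close> is skipped.\<close>
      let ?ys = "(as @ [z]) @ tl (z # cs)"
      have "sublist (as @ [z]) xs" unfolding sublist_def xs by (rule exI[of _ "[]"]) auto
      then have "walk V E (as @ [z])" using walk_sublist[OF 1(2)] by simp
      moreover have "walk V E (z # cs)"
      proof (rule walk_sublist[OF 1(2)])
        show "sublist (z # cs) xs" unfolding sublist_def xs by (rule exI[of _ "as @ [z] @ bs"]) auto
      qed simp
      ultimately have "walk V E ?ys" "hd ?ys = hd (as @ [z])" "last ?ys = last (z # cs)"
        using walk_join[of V E "as @ [z]" "z # cs"] by auto
      moreover have "hd (as @ [z]) = u" "last (z # cs) = v" using 1 xs by (cases as; auto)+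
      moreover have "length ?ys < length xs" using xs by simp
      ultimately show ?thesis using 1(1)[rule_format, of ?ys] by simp
    qed (use 1 in blast)
  qed
  moreover obtain xs where "walk V E xs" "hd xs = u" "last xs = v"
    using assms unfolding reachable_def by auto
  ultimately show ?thesis using that by metis
qed

text \<open>Bridges are defined by counting components. If the ends stayed connected, every use of
  the edge in a walk could be bypassed, so reachability and hence the set of components would not
  change.\<close>

lemma bridge_not_reachable:
  assumes "bridge V E {x, y}"
  shows "\<not> reachable V (E - {{x, y}}) x y"
proof
  assume r: "reachable V (E - {{x, y}}) x y"
  have "reachable V (E - {{x, y}}) (hd xs) (last xs)" if "walk V E xs" for xs
    using that
  proof (induction xs rule: walk_edges.induct)
    case (3 u v xs)
    have "walk V E (v # xs)" "{u, v} \<in> E" "u \<in> V" "v \<in> V" using 3(2) by (auto simp: walk_def)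
    then have "reachable V (E - {{x, y}}) u v"
      using r reachable_sym[OF r] reachable_edge[of u v "E - {{x, y}}" V]
      by (cases "{u, v} = {x, y}") (auto simp: doubleton_eq_iff)
    then show ?case using 3(1)[OF \<open>walk V E (v # xs)\<close>] reachable_trans by fastforce
  qed (auto simp: walk_def intro: reachable_refl)
  then have "reachable V E u v \<Longrightarrow> reachable V (E - {{x, y}}) u v" for u v
    unfolding reachable_def[of V E] by metis
  then have "reachable V E = reachable V (E - {{x, y}})"
    by (intro ext iffI) (auto elim: reachable_mono)
  then show False using assms unfolding bridge_def components_def by simp
qed

section \<open>Rotations and layers\<close>

text \<open>Rotations reverse an initial part of a trail, so segments can be tracked only up to
  reversal.\<close>

definition subtrail :: "'a list \<Rightarrow> 'a list \<Rightarrow> bool" where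
  "subtrail s W \<longleftrightarrow> sublist s W \<or> sublist (rev s) W"

lemma subtrail_rev: "subtrail s (rev W) \<longleftrightarrow> subtrail s W"
  unfolding subtrail_def by (metis rev_rev_ident sublist_rev)

lemma edge_nonempty: "g \<in> edges_of xs \<Longrightarrow> g \<noteq> {}"
  by (induction xs rule: walk_edges.induct) auto

text \<open>In the application \<open>E\<close> is the edge set of the graph without the bridge,
  \<open>R\<close> lacks the edges of the circuit as well, \<open>F\<close> contains the prescribed
  circuit edges, and \<open>W0\<close> lists the circuit opened at an edge of
  \<open>F\<close>.\<close>

locale open_trail =
  fixes V :: "'a set" and E R F :: "'a set set" and W0 :: "'a list"
  assumes R_subset: "R \<subseteq> E" and W0_in_V: "set W0 \<subseteq> V"
begin

text \<open>\<open>D\<close> collects the components of \<open>R\<close> that must stay untouched for later rotations.\<close>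

definition covers :: "'a set \<Rightarrow> 'a list \<Rightarrow> bool" where
  "covers D W \<longleftrightarrow> trail V E W \<and> F \<subseteq> edges_of W \<and> (\<forall>g\<in>edges_of W \<inter> R. g \<inter> D = {})
     \<and> set W \<inter> D \<subseteq> set W0"

lemma covers_mono: "covers D W \<Longrightarrow> D' \<subseteq> D \<Longrightarrow> covers D' W"
  unfolding covers_def by blast

lemma covers_rev: "covers D (rev W) \<longleftrightarrow> covers D W"
  unfolding covers_def trail_def by (simp add: walk_rev walk_edges_rev)

text \<open>Segments need not be maximal: every nonempty \<open>F\<close>-free stretch counts, even
  a single vertex. Thus the part of a segment between two of its vertices is again a
  segment.\<close>

definition seg :: "'a list \<Rightarrow> bool" where
  "seg s \<longleftrightarrow> s \<noteq> [] \<and> sublist s W0 \<and> edges_of s \<inter> F = {}"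

text \<open>Both ends of the same segment must have been reached before its other vertices are
  added; this makes the union of all stages meet each segment in an interval.\<close>

primrec layer :: "'a \<Rightarrow> nat \<Rightarrow> 'a set" where
  "layer x 0 = {v. reachable V R x v}"
| "layer x (Suc n) = layer x n \<union>
     {v. \<exists>s c. seg s \<and> hd s \<in> layer x n \<and> last s \<in> layer x n \<and> c \<in> set s \<and> reachable V R c v}"

lemma layer_mono: "m \<le> n \<Longrightarrow> layer x m \<subseteq> layer x n"
  by (induction n) (auto simp: le_Suc_eq)

lemma layer_closed: "v \<in> layer x n \<Longrightarrow> reachable V R v w \<Longrightarrow> w \<in> layer x n"
proof (induction n arbitrary: v w)
  case 0
  then show ?case by (auto intro: reachable_trans)
next
  case (Suc n)
  show ?case
  proof (cases "v \<in> layer x n")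
    case True
    then show ?thesis using Suc by simp
  next
    case False
    then obtain s c where "seg s" "hd s \<in> layer x n" "last s \<in> layer x n" "c \<in> set s"
      "reachable V R c v" using Suc.prems(1) by auto
    moreover from this have "reachable V R c w" using reachable_trans Suc.prems(2) by metis
    ultimately show ?thesis by auto
  qed
qed

lemma layer_in_V: "layer x n \<subseteq> V"
  by (induction n) (auto dest: reachable_in)

lemma seg_in_layer:
  assumes "seg s" "hd s \<in> layer x n" "last s \<in> layer x n"
  shows "set s \<subseteq> layer x (Suc n)"
proof
  fix c assume "c \<in> set s"
  moreover have "set s \<subseteq> V"
    using assms(1) W0_in_V set_mono_sublist[of s W0] by (auto simp: seg_def)
  ultimately have "reachable V R c c" by (auto intro: reachable_refl)
  with \<open>c \<in> set s\<close>
  show "c \<in> layer x (Suc n)" using assms by auto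
qed

text \<open>The \<open>F\<close>-free stretch from \<open>w\<close> to \<open>c\<close> is given up,
  and the old first vertex is joined to \<open>c\<close> inside its component \<open>C\<close> of
  \<open>R\<close>, so that \<open>w\<close> becomes the new first vertex. The component
  \<open>C\<close> is used up and leaves the protected set \<open>D\<close>.\<close>

lemma rotation:
  assumes cov: "covers D W" and W: "W = X @ w # M @ c # Y"
    and free: "edges_of (w # M @ [c]) \<inter> F = {}"
    and con: "reachable V R (hd W) c" and D: "C \<subseteq> D" and C: "C = {v. reachable V R (hd W) v}"
  obtains W' where "covers (D - C) W'" "hd W' = w" "last W' = last W"
    "\<And>s. \<lbrakk>subtrail s W; s \<noteq> []; c \<notin> set s; hd s \<notin> set M; last s \<notin> set M\<rbrakk> \<Longrightarrow> subtrail s W'"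
proof -
  obtain P where P: "walk V R P" "hd P = hd W" "last P = c" "distinct P"
    using reachable_simple_path[OF con] .
  have Pne: "P \<noteq> []" using P(1) by (simp add: walk_def)
  have Pcomp: "set P \<subseteq> C" using walk_reachable[OF P(1)] P(2) C by auto
  have PR: "edges_of P \<subseteq> R" using P(1) by (simp add: walk_def)
  \<comment> \<open>Backwards from \<open>w\<close> to the old first vertex, then along
    \<open>P\<close> to \<open>c\<close>.\<close>
  define Z where "Z = rev (X @ [w]) @ tl P"
  define W' where "W' = Z @ tl (c # Y)"
  have lastX: "last (rev (X @ [w])) = hd P" using P(2) W by (cases X) auto
  have weZ: "walk_edges Z = rev (walk_edges (X @ [w])) @ walk_edges P"
    unfolding Z_def walk_edges_rev[symmetric] by (rule walk_edges_join) (use Pne lastX in auto)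
  have lastZ: "last Z = c" "Z \<noteq> []"
    using P(3) lastX Pne unfolding Z_def by (cases P; cases "tl P"; auto)+
  have we': "walk_edges W' = rev (walk_edges (X @ [w])) @ walk_edges P @ walk_edges (c # Y)"
    using lastZ unfolding W'_def by (subst walk_edges_join) (auto simp: weZ)
  have "walk_edges ((X @ [w]) @ tl ((w # M @ [c]) @ tl (c # Y)))
      = walk_edges (X @ [w]) @ walk_edges (w # M @ [c]) @ walk_edges (c # Y)"
    by (subst walk_edges_join, simp, simp, simp, subst walk_edges_join) auto
  then have we: "walk_edges W = walk_edges (X @ [w]) @ walk_edges (w # M @ [c]) @ walk_edges (c # Y)"
    using W by simp
  \<comment> \<open>\<open>P\<close> consists of edges of \<open>R\<close> inside \<open>C\<close>,
    hence inside \<open>D\<close>, while \<open>W\<close> has no edge of \<open>R\<close> meeting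
    \<open>D\<close>.\<close>
  have new: "edges_of P \<inter> edges_of W = {}"
  proof (rule ccontr)
    assume "edges_of P \<inter> edges_of W \<noteq> {}"
    then obtain g where g: "g \<in> edges_of P" "g \<in> edges_of W" by auto
    have "g \<subseteq> D" using edge_subset_verts[OF g(1)] Pcomp D by simp
    moreover have "g \<inter> D = {}" using g cov PR by (auto simp: covers_def)
    ultimately show False using edge_nonempty[OF g(1)] by blast
  qed
  have "distinct (walk_edges W')"
    using cov new distinct_walk_edges[OF P(4)] unfolding covers_def trail_def we we' by auto
  moreover have verts: "set W' \<subseteq> set W \<union> set P"
    using W by (auto simp: W'_def Z_def dest: list.set_sel(2)[OF Pne])
  moreover have "set W \<subseteq> V" "set P \<subseteq> V" "edges_of P \<subseteq> E" "edges_of W \<subseteq> E"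
    using cov P(1) R_subset unfolding covers_def trail_def walk_def by auto
  moreover have edges': "edges_of W' \<subseteq> edges_of W \<union> edges_of P" using we we' by auto
  ultimately have "trail V E W'" unfolding trail_def walk_def using W'_def lastZ(2) by auto
  moreover have "F \<subseteq> edges_of W'" using cov free unfolding covers_def we we' by auto
  moreover have "g \<inter> (D - C) = {}" if "g \<in> edges_of W' \<inter> R" for g
  proof (cases "g \<in> edges_of P")
    case True
    then show ?thesis using edge_subset_verts[OF True] Pcomp by auto
  next
    case False
    then have "g \<in> edges_of W \<inter> R" using that edges' by auto
    then show ?thesis using cov by (auto simp: covers_def)
  qed
  moreover have "set W' \<inter> (D - C) \<subseteq> set W0"
    using verts Pcomp cov by (auto simp: covers_def)
  ultimately have "covers (D - C) W'" by (simp add: covers_def)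
  moreover have "hd W' = w" by (simp add: W'_def Z_def)
  moreover have "last W' = last W" using lastZ W by (auto simp: W'_def)
  moreover have "subtrail s W'"
    if s: "subtrail s W" "s \<noteq> []" "c \<notin> set s" "hd s \<notin> set M" "last s \<notin> set M" for s
  proof -
    have *: "subtrail r W'" if r: "sublist r W" "r \<noteq> []" "c \<notin> set r" "hd r \<notin> set M" "last r \<notin> set M" for r
    proof -
      have "sublist r ((X @ [w]) @ (M @ [c]) @ Y)" using r(1) W by simp
      moreover have "hd r \<notin> set (M @ [c])" "last r \<notin> set (M @ [c])"
        using r hd_in_set[OF r(2)] last_in_set[OF r(2)] by auto
      \<comment> \<open>The third alternative, that \<open>r\<close> contains the whole removed
        stretch, fails because \<open>r\<close> avoids \<open>c\<close>.\<close>
      ultimately have "sublist r (X @ [w]) \<or> sublist r Y"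
        using sublist_avoiding[of r "X @ [w]" "M @ [c]" Y] r(2,3) by simp
      then have "sublist (rev r) (rev (X @ [w])) \<or> sublist r Y" by (simp only: sublist_rev)
      moreover have "sublist (rev (X @ [w])) W'"
        unfolding W'_def Z_def sublist_def by (rule exI[of _ "[]"]) auto
      moreover have "sublist Y W'" by (simp add: W'_def)
      ultimately show ?thesis unfolding subtrail_def using sublist_order.order.trans by metis
    qed
    show ?thesis
    proof (cases "sublist s W")
      case True
      then show ?thesis using * s by blast
    next
      case False
      then have "subtrail (rev s) W'" using s by (intro *) (auto simp: subtrail_def hd_rev last_rev)
      then show ?thesis unfolding subtrail_def by auto
    qed
  qed
  ultimately show ?thesis by (rule that)
qed

text \<open>Induction on the stage of the first vertex, with one rotation whenever the stage really
  drops. Segments of lower stages must remain in the trail for later rotations; \<open>Q\<close> and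
  \<open>K\<close> hold the components and segments reserved for the descent at the other
  end.\<close>

lemma descend_to_component:
  assumes "covers (layer x i \<union> Q) W" "hd W \<in> layer x i"
    and "\<And>s m. \<lbrakk>seg s; m < i; hd s \<in> layer x m; last s \<in> layer x m\<rbrakk> \<Longrightarrow>
      subtrail s W \<and> set s \<inter> Q = {} \<and> (\<forall>r\<in>K. set s \<inter> set r = {})"
    and "\<And>r. r \<in> K \<Longrightarrow> r \<noteq> [] \<and> subtrail r W"
    and Q: "\<And>u v. u \<in> Q \<Longrightarrow> reachable V R u v \<Longrightarrow> v \<in> Q"
  shows "\<exists>W'. covers (layer x 0 \<union> Q) W' \<and> hd W' \<in> layer x 0 \<and> last W' = last W \<and>
    (\<forall>r\<in>K. subtrail r W')"
  using assms(1-4)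
proof (induction i arbitrary: W)
  case 0
  then show ?case by blast
next
  case (Suc i)
  show ?case
  proof (cases "hd W \<in> layer x i")
    case True
    have "covers (layer x i \<union> Q) W"
      by (rule covers_mono[OF Suc.prems(1)]) auto
    moreover have "subtrail r W \<and> set r \<inter> Q = {} \<and> (\<forall>r'\<in>K. set r \<inter> set r' = {})"
      if r: "seg r" "m < i" "hd r \<in> layer x m" "last r \<in> layer x m" for r m
      using Suc.prems(3)[OF r(1) _ r(3,4)] r(2) by auto
    ultimately show ?thesis using Suc.IH[of W] True Suc.prems(4) by presburger
  next
    case False
    define C where "C = {v. reachable V R (hd W) v}"
    obtain s c where s: "seg s" "hd s \<in> layer x i" "last s \<in> layer x i" "c \<in> set s" "reachable V R c (hd W)"
      using False Suc.prems(2) by auto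
    have c: "c \<notin> layer x i" using s(5) False layer_closed by blast
    have sW: "subtrail s W" and sQ: "set s \<inter> Q = {}" and sK: "\<forall>r\<in>K. set s \<inter> set r = {}"
      using Suc.prems(3)[OF s(1) _ s(2,3)] by auto
    \<comment> \<open>\<open>t\<close> is \<open>s\<close> in the direction in which it occurs in
      \<open>W\<close>.\<close>
    obtain t where t: "sublist t W" "set t = set s" "edges_of t \<inter> F = {}" "hd t \<in> layer x i"
    proof (cases "sublist s W")
      case True
      then show ?thesis using that[of s] s unfolding seg_def by blast
    next
      case False
      then show ?thesis using that[of "rev s"] sW s unfolding subtrail_def seg_def
        by (auto simp: walk_edges_rev hd_rev)
    qed
    obtain t1 t2 where t12: "t = t1 @ c # t2" using s(4) t(2) by (metis split_list)
    have "\<exists>w\<in>set t1. w \<in> layer x i" using t(4) c t12 by (cases t1) auto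
    \<comment> \<open>\<open>w\<close> is the last vertex of \<open>layer x i\<close> before
      \<open>c\<close>. So \<open>M\<close> avoids this layer, and no segment of a lower stage has
      an end in \<open>M\<close>.\<close>
    then obtain t0 w M where w: "t1 = t0 @ w # M" "w \<in> layer x i" "\<forall>z\<in>set M. z \<notin> layer x i"
      using split_list_last_prop[of t1 "\<lambda>z. z \<in> layer x i"] by blast
    obtain L N where LN: "W = L @ t @ N" using t(1) unfolding sublist_def by blast
    have W: "W = (L @ t0) @ w # M @ c # (t2 @ N)" using LN t12 w(1) by simp
    have "sublist (w # M @ [c]) t" unfolding sublist_def t12 w(1) by (metis append.assoc append_Cons append_Nil)
    then have free: "edges_of (w # M @ [c]) \<inter> F = {}" using edges_of_sublist t(3) by blast
    \<comment> \<open>\<open>C\<close> is the component of \<open>c\<close>, a vertex of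
      \<open>s\<close>. As \<open>s\<close> avoids \<open>Q\<close> and \<open>Q\<close> is a union
      of components, the rotation does not touch \<open>Q\<close>.\<close>
    have CQ: "C \<inter> Q = {}"
    proof -
      have "v \<notin> Q" if "reachable V R (hd W) v" for v
        using Q[of v c] reachable_trans[OF s(5) that] reachable_sym[of V R c v] sQ s(4) by blast
      then show ?thesis unfolding C_def by blast
    qed
    have Cl: "C \<inter> layer x i = {}"
    proof -
      have "v \<notin> layer x i" if "reachable V R (hd W) v" for v
        using layer_closed[of v x i "hd W"] reachable_sym[OF that] False by blast
      then show ?thesis unfolding C_def by blast
    qed
    have CS: "C \<subseteq> layer x (Suc i)"
      unfolding C_def using layer_closed[OF Suc.prems(2)] by (rule subsetI) (simp only: mem_Collect_eq)
    obtain W' where W': "covers ((layer x (Suc i) \<union> Q) - C) W'" "hd W' = w" "last W' = last W"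
      "\<And>s. \<lbrakk>subtrail s W; s \<noteq> []; c \<notin> set s; hd s \<notin> set M; last s \<notin> set M\<rbrakk> \<Longrightarrow> subtrail s W'"
    proof (rule rotation[OF Suc.prems(1) W free reachable_sym[OF s(5)]])
      show "C \<subseteq> layer x (Suc i) \<union> Q" using CS by (rule le_supI1)
    qed (rule C_def, rule that)
    have cov': "covers (layer x i \<union> Q) W'"
      by (rule covers_mono[OF W'(1)]) (use CQ Cl in auto)
    have sub': "subtrail r W'" if r: "seg r" "m < i" "hd r \<in> layer x m" "last r \<in> layer x m" for r m
    proof (rule W'(4))
      show "subtrail r W" using Suc.prems(3)[OF r(1) _ r(3,4)] r(2) by auto
      show "r \<noteq> []" using r(1) by (simp add: seg_def)
      \<comment> \<open>A segment with ends in stage \<open>m\<close> lies in stage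
        \<open>Suc m\<close>, which is at most \<open>i\<close>, whereas \<open>c\<close> is outside
        stage \<open>i\<close>.\<close>
      show "c \<notin> set r" using seg_in_layer[OF r(1,3,4)] layer_mono[of "Suc m" i] r(2) c
        by (meson Suc_leI subsetD)
      show "hd r \<notin> set M" "last r \<notin> set M" using r(2-4) w(3) layer_mono[of m i] by (meson less_imp_le subsetD)+
    qed
    have keep': "r \<noteq> [] \<and> subtrail r W'" if r: "r \<in> K" for r
    proof -
      have "r \<noteq> []" "subtrail r W" using Suc.prems(4)[OF r] by auto
      moreover have "set M \<subseteq> set s" using t(2) t12 w(1) by auto
      ultimately show ?thesis using W'(4)[of r] sK r s(4) hd_in_set[of r] last_in_set[of r] by blast
    qed
    have hd': "hd W' \<in> layer x i" using w(2) W'(2) by simp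
    have trip': "subtrail r W' \<and> set r \<inter> Q = {} \<and> (\<forall>r'\<in>K. set r \<inter> set r' = {})"
      if r: "seg r" "m < i" "hd r \<in> layer x m" "last r \<in> layer x m" for r m
      using Suc.prems(3)[OF r(1) _ r(3,4)] r(2) sub'[OF r] by auto
    show ?thesis unfolding W'(3)[symmetric] by (rule Suc.IH[OF cov' hd' trip' keep'])
  qed
qed

text \<open>The paths used for closing lie in the components of \<open>x\<close> and
  \<open>y\<close>. These are different, and \<open>W\<close> uses none of their edges, so no edge
  is repeated.\<close>

lemma closing_circuit:
  assumes cov: "covers (layer x 0 \<union> layer y 0) W"
    and hd: "hd W \<in> layer x 0" and last: "last W \<in> layer y 0"
    and xy: "\<not> reachable V R x y" "x \<in> V" "y \<in> V" and new: "{x, y} \<notin> E"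
  obtains H' where "circuit V (insert {x, y} E) H'" "insert {x, y} F \<subseteq> edges_of H'"
    "\<And>z. z \<in> {x, y} \<Longrightarrow> z \<notin> set W0 \<Longrightarrow> passes_exactly_once H' z"
proof -
  have W: "walk V E W" "W \<noteq> []" "distinct (walk_edges W)" "F \<subseteq> edges_of W" "edges_of W \<subseteq> E"
    using cov by (auto simp: covers_def trail_def walk_def)
  have avoid: "g \<inter> (layer x 0 \<union> layer y 0) = {}" if "g \<in> edges_of W" "g \<in> R" for g
    using cov that by (simp add: covers_def)
  obtain P where P: "walk V R P" "hd P = x" "last P = hd W" "distinct P"
    using reachable_simple_path[of V R x "hd W"] hd by auto
  obtain Q where Q: "walk V R Q" "hd Q = last W" "last Q = y" "distinct Q"
    using reachable_simple_path[of V R "last W" y] reachable_sym[of V R y "last W"] last by auto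
  have ne: "P \<noteq> []" "Q \<noteq> []" using P(1) Q(1) by (auto simp: walk_def)
  have PR: "edges_of P \<subseteq> R" and QR: "edges_of Q \<subseteq> R" using P(1) Q(1) by (auto simp: walk_def)
  have Pl: "set P \<subseteq> layer x 0" using walk_reachable[OF P(1)] P(2) by auto
  have Ql: "set Q \<subseteq> layer y 0"
  proof
    fix v assume "v \<in> set Q"
    then have "reachable V R (last W) v" using walk_reachable[OF Q(1)] Q(2) by auto
    then show "v \<in> layer y 0" using layer_closed[OF last] by blast
  qed
  have disj: "layer x 0 \<inter> layer y 0 = {}"
  proof -
    have False if "reachable V R x v" "reachable V R y v" for v
      using reachable_trans[OF that(1) reachable_sym[OF that(2)]] xy(1) by contradiction
    then show ?thesis by auto
  qed
  have PE: "walk V E P" "walk V E Q" using P(1) Q(1) R_subset by (auto simp: walk_def)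
  define Z where "Z = (P @ tl W) @ tl Q"
  define H' where "H' = Z @ tl [y, x]"
  have 1: "walk V E (P @ tl W)" "hd (P @ tl W) = x" "last (P @ tl W) = last W"
    using walk_join[OF PE(1) W(1) P(3)] P(2) by auto
  have 2: "walk V E Z" "hd Z = x" "last Z = y"
    using walk_join[OF 1(1) PE(2)] 1 Q unfolding Z_def by auto
  have Zne: "Z \<noteq> []" using 2(1) by (simp add: walk_def)
  have weZ: "walk_edges Z = walk_edges P @ walk_edges W @ walk_edges Q"
    using walk_edges_join[of "P @ tl W" Q] walk_edges_join[OF ne(1) W(2) P(3)] ne Q(2) 1(3)
    unfolding Z_def by simp
  have we: "walk_edges H' = walk_edges Z @ [{y, x}]"
    unfolding H'_def using Zne 2(3) by (subst walk_edges_join) auto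
  have touch: "g \<inter> layer x 0 \<noteq> {}" if "g \<in> edges_of P" for g
    using edge_subset_verts[OF that] edge_nonempty[OF that] Pl by blast
  have touch': "g \<subseteq> layer y 0 \<and> g \<noteq> {}" if "g \<in> edges_of Q" for g
    using edge_subset_verts[OF that] edge_nonempty[OF that] Ql by blast
  have "g \<notin> edges_of W" if "g \<in> edges_of P" for g
    using avoid[of g] PR touch[OF that] that by blast
  then have "edges_of P \<inter> edges_of W = {}" by auto
  moreover have "g \<notin> edges_of W" if "g \<in> edges_of Q" for g
    using avoid[of g] QR touch'[OF that] that by blast
  then have "edges_of W \<inter> edges_of Q = {}" by auto
  moreover have "g \<notin> edges_of P" if "g \<in> edges_of Q" for g
    using touch[of g] touch'[OF that] disj by blast
  then have "edges_of P \<inter> edges_of Q = {}" by auto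
  moreover have "{y, x} \<notin> edges_of Z"
    using 2(1) new by (auto simp: walk_def insert_commute)
  ultimately have "distinct (walk_edges H')"
    using W(3) distinct_walk_edges[OF P(4)] distinct_walk_edges[OF Q(4)] by (auto simp: we weZ)
  moreover have "walk V (insert {x, y} E) H'"
  proof -
    have "set H' \<subseteq> V" using 2(1) xy(2) by (auto simp: walk_def H'_def)
    moreover have "edges_of H' \<subseteq> insert {x, y} E" using 2(1) by (auto simp: walk_def we insert_commute)
    ultimately show ?thesis using Zne by (simp add: walk_def H'_def)
  qed
  moreover have "hd H' = last H'" using 2 Zne by (simp add: H'_def)
  ultimately have "circuit V (insert {x, y} E) H'" by (simp add: circuit_def trail_def)
  moreover have "insert {x, y} F \<subseteq> edges_of H'" using W(4) by (auto simp: we weZ insert_commute)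
  moreover have "passes_exactly_once H' z" if z: "z \<in> {x, y}" "z \<notin> set W0" for z
  proof -
    have inl: "x \<in> layer x 0" "y \<in> layer y 0" using xy reachable_refl by auto
    \<comment> \<open>By the last clause of \<open>covers\<close>, the trail meets the two
      components only in vertices of \<open>W0\<close>; hence the single visit to \<open>z\<close>
      is on a simple path.\<close>
    then have zW: "z \<notin> set W" using z cov by (auto simp: covers_def)
    then have ztW: "z \<notin> set (tl W)" using W(2) list.set_sel(2) by metis
    have cnt: "count_list l z = 1" if "distinct l" "z \<in> set l" for l
      using that by (induction l) (auto simp: count_notin)
    have "butlast H' = Z" by (simp add: H'_def)
    then have "butlast H' = P @ tl W @ tl Q" by (simp add: Z_def)
    moreover have "count_list (P @ tl W @ tl Q) z = 1"
    proof (cases "z = x")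
      case True
      then have "z \<in> set P" "z \<notin> set Q" using P(2) ne inl Ql disj by auto
      moreover from this have "z \<notin> set (tl Q)" using ne(2) list.set_sel(2) by metis
      ultimately show ?thesis using cnt[OF P(4)] ztW by (simp add: count_notin)
    next
      case False
      then have zy: "z = y" using z by simp
      then have "z \<notin> set P" using inl Pl disj by auto
      moreover have "z \<in> set Q" using zy Q(3) ne last_in_set by metis
      \<comment> \<open>Joining drops the first vertex of \<open>Q\<close>, so it has to be another
        vertex than \<open>z\<close>.\<close>
      moreover have "z \<noteq> hd Q" using zW Q(2) W(2) last_in_set by metis
      ultimately have "z \<in> set (tl Q)" "z \<notin> set P" "distinct (tl Q)"
        using Q(4) ne by (cases Q; auto)+
      then show ?thesis using cnt ztW by (simp add: count_notin)
    qed
    ultimately show ?thesis by (simp add: passes_exactly_once_def)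
  qed
  ultimately show ?thesis by (rule that)
qed

end

section \<open>Removing a stretch that links the two closures\<close>

lemma sublist_between:
  assumes "a \<in> set z" "b \<in> set z"
  obtains u where "sublist u z" "u \<noteq> []" "hd u = a \<and> last u = b \<or> hd u = b \<and> last u = a"
proof -
  obtain z1 z2 where z: "z = z1 @ a # z2" using assms(1) by (meson split_list)
  consider "b = a" | "b \<in> set z1" | "b \<in> set z2" using assms(2) z by auto
  then show ?thesis
  proof cases
    case 1
    have "sublist [a] z" unfolding sublist_def z by (intro exI[of _ z1] exI[of _ z2]) simp
    then show ?thesis using that[of "[a]"] 1 by simp
  next
    case 2
    then obtain z3 z4 where "z1 = z3 @ b # z4" by (meson split_list)
    then have "sublist (b # z4 @ [a]) z"
      unfolding sublist_def z by (intro exI[of _ z3] exI[of _ z2]) simp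
    then show ?thesis using that[of "b # z4 @ [a]"] by simp
  next
    case 3
    then obtain z3 z4 where "z2 = z3 @ b # z4" by (meson split_list)
    then have "sublist (a # z3 @ [b]) z"
      unfolding sublist_def z by (intro exI[of _ z1] exI[of _ z4]) simp
    then show ?thesis using that[of "a # z3 @ [b]"] by simp
  qed
qed

locale closed_trail = open_trail +
  fixes f :: "'a set"
  assumes trail_W0: "trail V E W0" and f_ends: "f = {last W0, hd W0}"
    and f_in: "f \<in> E" "f \<in> F" and f_new: "f \<notin> edges_of W0"
    and F_subset: "F \<subseteq> insert f (edges_of W0)"
    and R_disjoint: "R \<inter> insert f (edges_of W0) = {}"
begin

lemma W0_ne: "W0 \<noteq> []"
  using trail_W0 by (simp add: trail_def walk_def)

text \<open>Starting at the end of \<open>u\<close>, go around through the closing edge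
  \<open>f\<close> to the start of \<open>u\<close>. The set \<open>D\<close> is arbitrary because
  this trail uses no edge of \<open>R\<close> and no vertex outside \<open>W0\<close>.\<close>

lemma cut_out_segment:
  assumes u: "seg u" and W0: "W0 = X @ u @ Y"
  obtains W where "covers D W" "hd W = last u" "last W = hd u"
    "\<And>s. sublist s X \<or> sublist s Y \<Longrightarrow> subtrail s W"
proof -
  have une: "u \<noteq> []" and free: "edges_of u \<inter> F = {}" using u by (auto simp: seg_def)
  define W where "W = (last u # Y) @ (X @ [hd u])"
  have "last (last u # Y) = last W0" "hd (X @ [hd u]) = hd W0"
    using W0 une by (auto simp: hd_append)
  then have we: "walk_edges W = walk_edges (last u # Y) @ f # walk_edges (X @ [hd u])"
    unfolding W_def f_ends by (subst walk_edges_append) simp_all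
  have "u @ Y = u @ tl (last u # Y)" by simp
  then have "walk_edges (u @ Y) = walk_edges u @ walk_edges (last u # Y)"
    using walk_edges_join[of u "last u # Y"] une by simp
  moreover have "W0 = (X @ [hd u]) @ tl (u @ Y)" using W0 une by simp
  then have "walk_edges W0 = walk_edges (X @ [hd u]) @ walk_edges (u @ Y)"
    using walk_edges_join[of "X @ [hd u]" "u @ Y"] une by simp
  ultimately have we0: "walk_edges W0 = walk_edges (X @ [hd u]) @ walk_edges u @ walk_edges (last u # Y)"
    by simp
  have sW: "set W \<subseteq> set W0" using W0 une by (auto simp: W_def)
  have eW: "edges_of W \<subseteq> insert f (edges_of W0)" by (auto simp: we we0)
  have "distinct (walk_edges W)" using trail_W0 f_new by (auto simp: trail_def we we0)
  moreover have "walk V E W"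
    using sW eW W0_in_V trail_W0 f_in by (auto simp: walk_def trail_def W_def)
  moreover have "F \<subseteq> edges_of W" using F_subset free by (auto simp: we we0)
  moreover have "edges_of W \<inter> R = {}" using R_disjoint eW by auto
  ultimately have "covers D W" using sW by (auto simp: covers_def trail_def)
  moreover have "hd W = last u" "last W = hd u" by (simp_all add: W_def)
  moreover have "subtrail s W" if "sublist s X \<or> sublist s Y" for s
  proof -
    have "sublist X W" unfolding W_def sublist_def
      by (intro exI[of _ "last u # Y"] exI[of _ "[hd u]"]) simp
    moreover have "sublist Y W" unfolding W_def sublist_def
      by (intro exI[of _ "[last u]"] exI[of _ "X @ [hd u]"]) simp
    ultimately show ?thesis using that sublist_order.order.trans unfolding subtrail_def by metis
  qed
  ultimately show ?thesis by (rule that)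
qed

text \<open>A linking segment with least stage sum \<open>i + j\<close> is chosen. Any interference
  between the removed stretch and the segments of the two descents would give a linking segment with
  a smaller sum.\<close>

lemma linked_components:
  assumes "seg z" "a \<in> set z" "a \<in> layer x i" "b \<in> set z" "b \<in> layer y j"
  obtains W where "covers (layer x 0 \<union> layer y 0) W" "hd W \<in> layer x 0" "last W \<in> layer y 0"
proof -
  define L where "L n \<longleftrightarrow> (\<exists>z i j a b. seg z \<and> a \<in> set z \<and> a \<in> layer x i \<and> b \<in> set z \<and>
    b \<in> layer y j \<and> i + j = n)" for n
  have "L (LEAST n. L n)" by (rule LeastI[of L "i + j"]) (use assms in \<open>unfold L_def, blast\<close>)
  then obtain z i j a b where z: "seg z" "a \<in> set z" "a \<in> layer x i" "b \<in> set z" "b \<in> layer y j"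
    and ij: "i + j = (LEAST n. L n)" unfolding L_def by auto
  have min: "i + j \<le> i' + j'"
    if "seg s" "c \<in> set s" "c \<in> layer x i'" "d \<in> set s" "d \<in> layer y j'" for s c d i' j'
    unfolding ij by (rule Least_le) (use that in \<open>unfold L_def, blast\<close>)
  obtain u where u: "sublist u z" "u \<noteq> []" "hd u = a \<and> last u = b \<or> hd u = b \<and> last u = a"
    using sublist_between[OF z(2,4)] .
  have ab: "a \<in> set u" "b \<in> set u" using u(2,3) hd_in_set last_in_set by metis+
  have "sublist u W0" using u(1) z(1) sublist_order.order.trans unfolding seg_def by blast
  moreover have "edges_of u \<inter> F = {}" using edges_of_sublist[OF u(1)] z(1) unfolding seg_def by blast
  ultimately have segu: "seg u" using u(2) by (simp add: seg_def)
  obtain X Y where W0: "W0 = X @ u @ Y" using \<open>sublist u W0\<close> unfolding sublist_def by blast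
  \<comment> \<open>If an end of \<open>s\<close> were in \<open>u\<close>, then \<open>u\<close>
    would link stages \<open>m\<close> and \<open>j\<close>; if \<open>s\<close> contained
    \<open>b\<close>, then \<open>s\<close> would. Both contradict minimality, so \<open>s\<close>
    lies on one side of \<open>u\<close>.\<close>
  have outx: "sublist s X \<or> sublist s Y"
    if s: "seg s" "m < i" "hd s \<in> layer x m" "last s \<in> layer x m" for s m
  proof -
    have *: "v \<notin> set u" if "v \<in> layer x m" for v
      using min[OF segu _ that ab(2) z(5)] s(2) by auto
    have "b \<notin> set s" using min[OF s(1) _ s(3) _ z(5)] s(1,2) by (auto simp: seg_def)
    then show ?thesis using sublist_avoiding[of s X u Y] s(1) W0 * s(3,4) ab(2) unfolding seg_def by auto
  qed
  have outy: "sublist s X \<or> sublist s Y"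
    if s: "seg s" "m < j" "hd s \<in> layer y m" "last s \<in> layer y m" for s m
  proof -
    have *: "v \<notin> set u" if "v \<in> layer y m" for v
      using min[OF segu ab(1) z(3) _ that] s(2) by auto
    have "a \<notin> set s" using min[OF s(1) _ z(3) _ s(3)] s(1,2) by (auto simp: seg_def)
    then show ?thesis using sublist_avoiding[of s X u Y] s(1) W0 * s(3,4) ab(1) unfolding seg_def by auto
  qed
  obtain W1 where W1: "covers (layer x i \<union> layer y j) W1" "hd W1 = a" "last W1 = b"
    "\<And>s. sublist s X \<or> sublist s Y \<Longrightarrow> subtrail s W1"
  proof -
    obtain W where W: "covers (layer x i \<union> layer y j) W" "hd W = last u" "last W = hd u"
      "\<And>s. sublist s X \<or> sublist s Y \<Longrightarrow> subtrail s W"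
      using cut_out_segment[OF segu W0] by blast
    show ?thesis
    proof (cases "hd u = a \<and> last u = b")
      case True
      then show ?thesis using that[of "rev W"] W
        by (auto simp: covers_rev subtrail_rev hd_rev last_rev)
    next
      case False
      then show ?thesis using that[of W] W u(3) by auto
    qed
  qed
  \<comment> \<open>These are the segments which the descent from the \<open>y\<close> end will use;
    the descent from the \<open>x\<close> end has to preserve them.\<close>
  define K where "K = {s. seg s \<and> (\<exists>m<j. hd s \<in> layer y m \<and> last s \<in> layer y m)}"
  have "\<exists>W'. covers (layer x 0 \<union> layer y j) W' \<and> hd W' \<in> layer x 0 \<and> last W' = last W1 \<and>
    (\<forall>r\<in>K. subtrail r W')"
  proof (rule descend_to_component[OF W1(1)])
    show "hd W1 \<in> layer x i" using W1(2) z(3) by simp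
    fix s m assume s: "seg s" "m < i" "hd s \<in> layer x m" "last s \<in> layer x m"
    have hs: "hd s \<in> set s" using s(1) by (simp add: seg_def)
    have "v \<notin> layer y j" if "v \<in> set s" for v
      using min[OF s(1) hs s(3) that] s(2) by fastforce
    \<comment> \<open>A common vertex has stage at most \<open>Suc m\<close> from \<open>x\<close>,
      and \<open>r\<close> starts in stage \<open>m'\<close> from \<open>y\<close>. Since
      \<open>Suc m\<close> is at most \<open>i\<close> and \<open>m' < j\<close>, the segment
      \<open>r\<close> would beat the minimum.\<close>
    moreover have "v \<notin> set r" if rv: "r \<in> K" "v \<in> set s" for r v
    proof
      assume v: "v \<in> set r"
      obtain m' where r: "seg r" "m' < j" "hd r \<in> layer y m'" using rv(1) by (auto simp: K_def)
      then have hr: "hd r \<in> set r" by (simp add: seg_def)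
      have "v \<in> layer x (Suc m)" using seg_in_layer[OF s(1,3,4)] rv(2) by blast
      then show False using min[OF r(1) v _ hr r(3)] s(2) r(2) by fastforce
    qed
    ultimately show "subtrail s W1 \<and> set s \<inter> layer y j = {} \<and> (\<forall>r\<in>K. set s \<inter> set r = {})"
      using W1(4)[OF outx[OF s]] by auto
  next
    fix r assume "r \<in> K"
    then show "r \<noteq> [] \<and> subtrail r W1" using W1(4) outy by (auto simp: K_def seg_def)
  qed (rule layer_closed)
  then obtain W2 where W2: "covers (layer x 0 \<union> layer y j) W2" "hd W2 \<in> layer x 0" "last W2 = b"
    "\<forall>r\<in>K. subtrail r W2" using W1(3) by auto
  \<comment> \<open>The second descent works on the reversed trail and protects only the component
    of \<open>x\<close>, which the other end has already reached.\<close>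
  have "\<exists>W'. covers (layer y 0 \<union> layer x 0) W' \<and> hd W' \<in> layer y 0 \<and> last W' = last (rev W2) \<and>
    (\<forall>r\<in>{}. subtrail r W')"
  proof (rule descend_to_component)
    show "covers (layer y j \<union> layer x 0) (rev W2)" using W2(1) by (simp only: covers_rev Un_commute)
    show "hd (rev W2) \<in> layer y j" using W2(3) z(5) by (simp add: hd_rev)
    fix s m assume s: "seg s" "m < j" "hd s \<in> layer y m" "last s \<in> layer y m"
    have hs: "hd s \<in> set s" using s(1) by (simp add: seg_def)
    have "v \<notin> layer x 0" if "v \<in> set s" for v
      using min[OF s(1) that _ hs s(3), of 0] s(2) by fastforce
    then show "subtrail s (rev W2) \<and> set s \<inter> layer x 0 = {} \<and> (\<forall>r\<in>{}. set s \<inter> set r = {})"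
      using W2(4) s by (auto simp: K_def subtrail_rev)
  qed (auto intro: reachable_trans)
  then obtain W3 where "covers (layer y 0 \<union> layer x 0) W3" "hd W3 \<in> layer y 0" "last W3 = hd W2"
    by (auto simp: last_rev)
  then show ?thesis using that[of "rev W3"] W2(2) by (simp add: covers_rev hd_rev last_rev Un_commute)
qed

end

section \<open>Counting exits\<close>

text \<open>Positions rather than vertices are collected, since a trail may leave the set several
  times from the same vertex.\<close>

definition exits :: "'a list \<Rightarrow> 'a set \<Rightarrow> nat set" where
  "exits xs S = {i. Suc i < length xs \<and> xs ! i \<in> S \<and> xs ! Suc i \<notin> S}"

lemma finite_exits: "finite (exits xs S)"
  by (rule finite_subset[of _ "{..<length xs}"]) (auto simp: exits_def)

text \<open>The indicator of \<open>S\<close> rises by one at each entry and falls by one at each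
  exit, and its changes along a closed walk sum to zero.\<close>

lemma card_exits_complement:
  assumes "xs \<noteq> []" "hd xs = last xs"
  shows "card (exits xs (- S)) = card (exits xs S)"
proof -
  let ?n = "length xs - 1" and ?h = "\<lambda>i. of_bool (xs ! i \<in> S) :: int"
  have *: "(\<Sum>i<?n. of_bool (xs ! i \<in> T \<and> xs ! Suc i \<notin> T)) = int (card (exits xs T))" for T
  proof -
    have "exits xs T = {i \<in> {..<?n}. xs ! i \<in> T \<and> xs ! Suc i \<notin> T}" by (auto simp: exits_def)
    then show ?thesis by (simp add: of_bool_def sum.If_cases Int_def)
  qed
  have "(\<Sum>i<?n. ?h (Suc i) - ?h i) = ?h ?n - ?h 0" by (rule sum_lessThan_telescope)
  also have "\<dots> = 0" using assms by (simp add: hd_conv_nth last_conv_nth)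
  finally have "0 = (\<Sum>i<?n. ?h (Suc i) - ?h i)" by simp
  also have "\<dots> = (\<Sum>i<?n. of_bool (xs ! i \<in> - S \<and> xs ! Suc i \<notin> - S)
      - of_bool (xs ! i \<in> S \<and> xs ! Suc i \<notin> S))"
    by (rule sum.cong) auto
  also have "\<dots> = int (card (exits xs (- S))) - int (card (exits xs S))"
    by (simp only: sum_subtractf *)
  finally show ?thesis by simp
qed

text \<open>Boundary edges correspond to exits and entries, one each because no edge repeats, and a
  closed walk has equally many of both.\<close>

lemma card_boundary_closed_trail:
  assumes "xs \<noteq> []" "hd xs = last xs" "distinct (walk_edges xs)"
  shows "card (edge_boundary (edges_of xs) S) = 2 * card (exits xs S)"
proof -
  let ?I = "exits xs S \<union> exits xs (- S)"
  have nth: "g \<in> edges_of xs \<longleftrightarrow> (\<exists>i. Suc i < length xs \<and> g = {xs ! i, xs ! Suc i})" for g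
  proof -
    have "i < length xs - 1 \<longleftrightarrow> Suc i < length xs" for i by linarith
    then show ?thesis unfolding in_set_conv_nth length_walk_edges using nth_walk_edges[of _ xs] by auto
  qed
  have "edge_boundary (edges_of xs) S = (!) (walk_edges xs) ` ?I"
  proof (intro equalityI subsetI)
    fix g assume "g \<in> edge_boundary (edges_of xs) S"
    then obtain i u v where i: "Suc i < length xs" "g = {xs ! i, xs ! Suc i}" "g = {u, v}" "u \<in> S" "v \<notin> S"
      unfolding edge_boundary_def nth by blast
    then have "i \<in> ?I" by (auto simp: exits_def doubleton_eq_iff)
    then show "g \<in> (!) (walk_edges xs) ` ?I" using i(1,2) nth_walk_edges[of i xs] by blast
  next
    fix g assume "g \<in> (!) (walk_edges xs) ` ?I"
    then obtain i where i: "i \<in> ?I" "g = {xs ! i, xs ! Suc i}" "Suc i < length xs"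
      using nth_walk_edges[of _ xs] by (auto simp: exits_def)
    then have "\<exists>u v. g = {u, v} \<and> u \<in> S \<and> v \<notin> S"
      unfolding exits_def by (auto simp: insert_commute)
    then show "g \<in> edge_boundary (edges_of xs) S" unfolding edge_boundary_def using nth i by auto
  qed
  moreover have "inj_on ((!) (walk_edges xs)) ?I"
    using assms(3) by (intro inj_on_nth) (auto simp: exits_def length_walk_edges)
  ultimately have "card (edge_boundary (edges_of xs) S) = card ?I" by (simp add: card_image)
  also have "\<dots> = card (exits xs S) + card (exits xs (- S))"
    by (rule card_Un_disjoint) (auto simp: finite_exits, auto simp: exits_def)
  finally show ?thesis using card_exits_complement[OF assms(1,2), of S] by simp
qed

text \<open>Every exit is charged to the first edge of \<open>F\<close> from there on; two exits charged to the same
  edge would lie on a common \<open>F\<close>-free stretch.\<close>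

lemma card_exits_le:
  assumes ws: "walk_edges xs \<noteq> []" "last (walk_edges xs) \<in> F" "distinct (walk_edges xs)" and fin: "finite F"
    and exA: "\<And>i j. \<lbrakk>i < j; i \<in> exits xs A; j \<in> exits xs A\<rbrakk> \<Longrightarrow> \<exists>l\<in>{i..<j}. walk_edges xs ! l \<in> F"
    and exB: "\<And>i j. \<lbrakk>i < j; i \<in> exits xs B; j \<in> exits xs B\<rbrakk> \<Longrightarrow> \<exists>l\<in>{i..<j}. walk_edges xs ! l \<in> F"
    and exAB: "\<And>i j. \<lbrakk>i < j; i \<in> exits xs A; j \<in> exits xs B\<rbrakk> \<Longrightarrow> \<exists>l\<in>{i..<j}. walk_edges xs ! l \<in> F"
    and exBA: "\<And>i j. \<lbrakk>i < j; i \<in> exits xs B; j \<in> exits xs A\<rbrakk> \<Longrightarrow> \<exists>l\<in>{i..<j}. walk_edges xs ! l \<in> F"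
    and disj: "exits xs A \<inter> exits xs B = {}"
  shows "card (exits xs A) + card (exits xs B) \<le> card F"
proof -
  let ?n = "length (walk_edges xs)" and ?I = "exits xs A \<union> exits xs B"
  \<comment> \<open>The least index exists because the last edge of the walk is in
    \<open>F\<close>.\<close>
  define g where "g i = (LEAST l. i \<le> l \<and> l < ?n \<and> walk_edges xs ! l \<in> F)" for i
  have g: "i \<le> g i \<and> g i < ?n \<and> walk_edges xs ! g i \<in> F" if "i \<in> ?I" for i
  proof -
    have "i < ?n" using that by (auto simp: exits_def length_walk_edges)
    then have "i \<le> ?n - 1 \<and> ?n - 1 < ?n \<and> walk_edges xs ! (?n - 1) \<in> F"
      using ws(1,2) by (auto simp: last_conv_nth)
    then show ?thesis unfolding g_def by (rule LeastI)
  qed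
  have less: "g i < j" if ij: "i \<in> ?I" "j \<in> ?I" "i < j" for i j
  proof -
    obtain l where l: "l \<in> {i..<j}" "walk_edges xs ! l \<in> F"
      using ij exA[of i j] exB[of i j] exAB[of i j] exBA[of i j] by auto
    have "l < ?n" using l ij(2) by (auto simp: exits_def length_walk_edges)
    then have "g i \<le> l" unfolding g_def using l by (intro Least_le) auto
    then show ?thesis using l by auto
  qed
  have "inj_on (\<lambda>i. walk_edges xs ! g i) ?I"
  proof (rule inj_onI)
    fix i j assume ij: "i \<in> ?I" "j \<in> ?I" "walk_edges xs ! g i = walk_edges xs ! g j"
    then have "g i = g j" using g[OF ij(1)] g[OF ij(2)] nth_eq_iff_index_eq[OF ws(3)] by simp
    then show "i = j" using less[OF ij(1,2)] less[OF ij(2,1)] g[OF ij(1)] g[OF ij(2)]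
      by (cases i j rule: linorder_cases) auto
  qed
  moreover have "(\<lambda>i. walk_edges xs ! g i) ` ?I \<subseteq> F" using g by blast
  ultimately have "card ?I \<le> card F" using fin by (intro card_inj_on_le)
  then show ?thesis using card_Un_disjoint[OF finite_exits finite_exits disj] by simp
qed

lemma edges_of_slice:
  assumes "g \<in> edges_of (take (Suc j - i) (drop i xs))" "j < length xs"
  shows "\<exists>l\<in>{i..<j}. g = walk_edges xs ! l"
proof -
  let ?s = "take (Suc j - i) (drop i xs)"
  obtain l where l: "l < length (walk_edges ?s)" "g = walk_edges ?s ! l"
    using assms(1) by (metis in_set_conv_nth)
  then have "Suc l < length ?s" unfolding length_walk_edges by linarith
  then have "g = {?s ! l, ?s ! Suc l}" "Suc (i + l) \<le> j" using l(2) nth_walk_edges[of l ?s] by auto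
  moreover from this have "?s ! l = xs ! (i + l)" "?s ! Suc l = xs ! Suc (i + l)"
    using assms(2) by (auto simp: nth_drop)
  ultimately have "g = walk_edges xs ! (i + l)" "i + l < j"
    using nth_walk_edges[of "i + l" xs] assms(2) by auto
  then show ?thesis by (intro bexI[of _ "i + l"]) auto
qed

section \<open>Exits of the circuit from the two closures, and odd cuts\<close>

context closed_trail
begin

text \<open>Closing up at the end makes \<open>f\<close>, an edge of \<open>F\<close>, the last
  edge, so every exit has an edge of \<open>F\<close> at or after it.\<close>

definition closed_walk :: "'a list" where
  "closed_walk = W0 @ [hd W0]"

lemma closed_walk:
  "closed_walk \<noteq> []" "hd closed_walk = last closed_walk"
  "walk_edges closed_walk = walk_edges W0 @ [f]" "distinct (walk_edges closed_walk)"
  using W0_ne trail_W0 f_new f_ends by (auto simp: closed_walk_def walk_edges_append trail_def)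

definition closure_layer :: "'a \<Rightarrow> 'a set" where
  "closure_layer x = (\<Union>n. layer x n)"

text \<open>The two ends may have been reached at different stages; the later stage contains
  both.\<close>

lemma closure_layer_convex:
  assumes "seg s" "hd s \<in> closure_layer x" "last s \<in> closure_layer x"
  shows "set s \<subseteq> closure_layer x"
proof -
  obtain m n where "hd s \<in> layer x m" "last s \<in> layer x n" using assms by (auto simp: closure_layer_def)
  then have "hd s \<in> layer x (max m n)" "last s \<in> layer x (max m n)"
    using layer_mono[of m "max m n" x] layer_mono[of n "max m n" x] by auto
  then have "set s \<subseteq> layer x (Suc (max m n))" using seg_in_layer assms(1) by blast
  then show ?thesis unfolding closure_layer_def by blast
qed

text \<open>An \<open>F\<close>-free stretch between two exits would be a segment. For exits from
  the same closure, convexity would put the vertex after the first exit into that closure; for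
  different closures, the segment would meet both.\<close>

lemma exit_counts:
  assumes unlinked: "\<And>s. seg s \<Longrightarrow> set s \<inter> closure_layer x = {} \<or> set s \<inter> closure_layer y = {}"
    and fin: "finite F"
  shows "card (exits closed_walk (closure_layer x)) + card (exits closed_walk (closure_layer y)) \<le> card F"
proof -
  let ?xs = closed_walk and ?n = "length W0"
  have nth: "?xs ! l = W0 ! l" if "l < ?n" for l using that by (simp add: closed_walk_def nth_append)
  have we: "walk_edges ?xs ! l = walk_edges W0 ! l" if "Suc l < ?n" for l
  proof -
    have "l < length (walk_edges W0)" using that unfolding length_walk_edges by linarith
    then show ?thesis by (simp add: closed_walk(3) nth_append)
  qed
  have slice: "\<exists>s. seg s \<and> hd s = ?xs ! i \<and> last s = ?xs ! j \<and> (i < j \<longrightarrow> ?xs ! Suc i \<in> set s)"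
    if ij: "i \<le> j" "j < ?n" "\<not> (\<exists>l\<in>{i..<j}. walk_edges ?xs ! l \<in> F)" for i j
  proof -
    let ?s = "take (Suc j - i) (drop i W0)"
    have ne: "?s \<noteq> []" using ij by auto
    have "sublist ?s W0" by (meson sublist_drop sublist_order.order.trans sublist_take)
    moreover have "edges_of ?s \<inter> F = {}"
    proof (rule ccontr)
      assume "edges_of ?s \<inter> F \<noteq> {}"
      then obtain l where "l \<in> {i..<j}" "walk_edges W0 ! l \<in> F" using edges_of_slice[OF _ ij(2)] by blast
      then show False using ij(2,3) we[of l] by (simp, metis atLeastLessThan_iff)
    qed
    moreover have "hd ?s = ?xs ! i" using ne ij nth[of i] by (simp add: hd_conv_nth)
    moreover have "last ?s = ?xs ! j" using ne ij nth[of j] by (simp add: last_conv_nth)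
    moreover have "?xs ! Suc i \<in> set ?s" if "i < j"
    proof -
      have "?s ! 1 \<in> set ?s" by (rule nth_mem) (use ij that in auto)
      then show ?thesis using ij that nth[of "Suc i"] by simp
    qed
    ultimately show ?thesis using ne unfolding seg_def by blast
  qed
  have idx: "i < ?n" if "i \<in> exits ?xs S" for i S using that by (auto simp: exits_def closed_walk_def)
  have same: "\<exists>l\<in>{i..<j}. walk_edges ?xs ! l \<in> F"
    if ij: "i < j" "i \<in> exits ?xs (closure_layer v)" "j \<in> exits ?xs (closure_layer v)" for i j v
  proof (rule ccontr)
    assume "\<not> ?thesis"
    then obtain s where "seg s" "hd s = ?xs ! i" "last s = ?xs ! j" "?xs ! Suc i \<in> set s"
      using slice[of i j] ij(1) idx[OF ij(3)] by auto
    then show False using closure_layer_convex[of s v] ij(2,3) by (auto simp: exits_def)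
  qed
  have diff: "\<exists>l\<in>{i..<j}. walk_edges ?xs ! l \<in> F"
    if ij: "i \<le> j" "j < ?n" "?xs ! i \<in> closure_layer x \<and> ?xs ! j \<in> closure_layer y \<or>
      ?xs ! i \<in> closure_layer y \<and> ?xs ! j \<in> closure_layer x" for i j
  proof (rule ccontr)
    assume "\<not> ?thesis"
    then obtain s where s: "seg s" "hd s = ?xs ! i" "last s = ?xs ! j" using slice[OF ij(1,2)] by auto
    then have "?xs ! i \<in> set s" "?xs ! j \<in> set s"
      unfolding s(2,3)[symmetric] by (simp_all add: seg_def)
    then show False using unlinked[OF s(1)] ij(3) by blast
  qed
  show ?thesis
  proof (rule card_exits_le[OF _ _ closed_walk(4) fin])
    show "walk_edges ?xs \<noteq> []" "last (walk_edges ?xs) \<in> F" using closed_walk(3) f_in by auto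
    show "exits ?xs (closure_layer x) \<inter> exits ?xs (closure_layer y) = {}"
    proof (rule ccontr)
      assume "\<not> ?thesis"
      then obtain i where i: "i \<in> exits ?xs (closure_layer x)" "i \<in> exits ?xs (closure_layer y)" by auto
      \<comment> \<open>For \<open>i = j\<close> the index range in \<open>diff\<close> is empty, so
        a common exit is impossible.\<close>
      then show False using diff[of i i] idx[OF i(1)] by (simp add: exits_def)
    qed
  next
    fix i j :: nat assume ij: "i < j"
    show "\<exists>l\<in>{i..<j}. walk_edges ?xs ! l \<in> F"
      if "i \<in> exits ?xs (closure_layer x)" "j \<in> exits ?xs (closure_layer x)" using same[OF ij that] .
    show "\<exists>l\<in>{i..<j}. walk_edges ?xs ! l \<in> F"
      if "i \<in> exits ?xs (closure_layer y)" "j \<in> exits ?xs (closure_layer y)" using same[OF ij that] .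
    show "\<exists>l\<in>{i..<j}. walk_edges ?xs ! l \<in> F"
      if "i \<in> exits ?xs (closure_layer x)" "j \<in> exits ?xs (closure_layer y)"
      using diff[of i j] ij idx[OF that(2)] that by (simp add: exits_def)
    show "\<exists>l\<in>{i..<j}. walk_edges ?xs ! l \<in> F"
      if "i \<in> exits ?xs (closure_layer y)" "j \<in> exits ?xs (closure_layer x)"
      using diff[of i j] ij idx[OF that(2)] that by (simp add: exits_def)
  qed
qed

text \<open>No edge of \<open>R\<close> leaves a union of components of \<open>R\<close>. So the
  boundary consists of the bridge and an even number of circuit edges, which makes it odd.\<close>

lemma card_boundary:
  assumes graph: "finite_simple_graph V (insert {x, y} E)" and E: "E \<subseteq> R \<union> insert f (edges_of W0)"
    and new: "{x, y} \<notin> E"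
    and S: "\<And>u v. u \<in> S \<Longrightarrow> reachable V R u v \<Longrightarrow> v \<in> S" "x \<in> S" "y \<notin> S"
  shows "card (edge_boundary (insert {x, y} E) S) = Suc (2 * card (exits closed_walk S))"
proof -
  have ed: "edges_of closed_walk = insert f (edges_of W0)" by (auto simp: closed_walk(3))
  have sub: "insert f (edges_of W0) \<subseteq> E" using f_in trail_W0 by (auto simp: trail_def walk_def)
  have noR: "g \<notin> R" if g: "g \<in> E" "g = {u, v}" "u \<in> S" "v \<notin> S" for g u v
  proof
    assume "g \<in> R"
    have "u \<in> V" "v \<in> V" using graph g by (auto simp: finite_simple_graph_def doubleton_eq_iff)
    then have "reachable V R u v" using reachable_edge[of u v R V] g(2) \<open>g \<in> R\<close> by simp
    then show False using S(1)[of u v] g(3,4) by simp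
  qed
  have "edge_boundary (insert {x, y} E) S = insert {x, y} (edge_boundary (edges_of closed_walk) S)"
  proof (intro equalityI subsetI)
    fix g assume g: "g \<in> edge_boundary (insert {x, y} E) S"
    then obtain u v where uv: "g = {u, v}" "u \<in> S" "v \<notin> S" unfolding edge_boundary_def by blast
    show "g \<in> insert {x, y} (edge_boundary (edges_of closed_walk) S)"
    proof (cases "g = {x, y}")
      case False
      then have "g \<in> E" using g by (auto simp: edge_boundary_def)
      then have "g \<in> edges_of closed_walk" using noR[OF _ uv] E ed by auto
      then show ?thesis using uv unfolding edge_boundary_def by blast
    qed simp
  next
    fix g assume "g \<in> insert {x, y} (edge_boundary (edges_of closed_walk) S)"
    moreover have "{x, y} \<in> edge_boundary (insert {x, y} E) S"
      using S(2,3) by (auto simp: edge_boundary_def)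
    moreover have "edge_boundary (edges_of closed_walk) S \<subseteq> edge_boundary (insert {x, y} E) S"
      using sub ed by (auto simp: edge_boundary_def)
    ultimately show "g \<in> edge_boundary (insert {x, y} E) S" by auto
  qed
  moreover have "{x, y} \<notin> edge_boundary (edges_of closed_walk) S"
    using new sub ed by (auto simp: edge_boundary_def)
  moreover have "finite (edge_boundary (edges_of closed_walk) S)" by (auto simp: edge_boundary_def)
  ultimately show ?thesis using card_boundary_closed_trail[OF closed_walk(1,2,4)] by simp
qed

text \<open>Without a link, both closures separate \<open>x\<close> from \<open>y\<close>. Their odd
  boundaries must be larger than \<open>k + 1\<close>, which forces more exits than \<open>F\<close>
  can be charged for.\<close>

lemma linking_segment:
  assumes graph: "finite_simple_graph V (insert {x, y} E)" and E: "E \<subseteq> R \<union> insert f (edges_of W0)"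
    and new: "{x, y} \<notin> E" and sep: "\<not> reachable V R x y" and xy: "x \<in> V" "y \<in> V"
    and cuts: "\<not> (\<exists>C. odd_cut V (insert {x, y} E) C \<and> card C \<le> k + 1)"
    and F: "finite F" "card F \<le> max 1 k"
  obtains z a b i j where "seg z" "a \<in> set z" "a \<in> layer x i" "b \<in> set z" "b \<in> layer y j"
proof (rule ccontr)
  note link = that
  assume "\<not> thesis"
  then have nolink: False
    if "seg z" "a \<in> set z" "a \<in> layer x i" "b \<in> set z" "b \<in> layer y j" for z a b i j
    using link[OF that] by contradiction
  have many: "k < 2 * card (exits closed_walk S)"
    if S: "S \<subseteq> V" "\<And>u v. u \<in> S \<Longrightarrow> reachable V R u v \<Longrightarrow> v \<in> S"
      "x \<in> S \<and> y \<notin> S \<or> y \<in> S \<and> x \<notin> S" for S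
  proof -
    have "card (edge_boundary (insert {x, y} E) S) = Suc (2 * card (exits closed_walk S))"
    proof (cases "x \<in> S")
      case True
      then show ?thesis using S(3) by (intro card_boundary[OF graph E new]) (auto intro: S(2))
    next
      case False
      then show ?thesis using S(3) graph new E unfolding insert_commute[of x y "{}"]
        by (intro card_boundary) (auto intro: S(2))
    qed
    moreover have "is_cut V (insert {x, y} E) (edge_boundary (insert {x, y} E) S)"
      using S(1) by (auto simp: is_cut_def)
    ultimately have "odd_cut V (insert {x, y} E) (edge_boundary (insert {x, y} E) S)"
      by (simp add: odd_cut_def)
    then have "\<not> card (edge_boundary (insert {x, y} E) S) \<le> k + 1" using cuts by blast
    then show ?thesis using \<open>card _ = _\<close> by simp
  qed
  have meets: "\<exists>b\<in>set W0. b \<in> S" if "k < 2 * card (exits closed_walk S)" for S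
  proof -
    have "exits closed_walk S \<noteq> {}" using that by auto
    then obtain i where "Suc i < length closed_walk" "closed_walk ! i \<in> S" by (auto simp: exits_def)
    moreover from this have "closed_walk ! i \<in> set closed_walk" by simp
    moreover have "set closed_walk = set W0" using W0_ne by (auto simp: closed_walk_def)
    ultimately show ?thesis by blast
  qed
  have single: "seg [b]" if "b \<in> set W0" for b
    using that split_list[of b W0] by (auto simp: seg_def sublist_def)
  have refl: "x \<in> layer x 0" "y \<in> layer y 0" using xy reachable_refl by auto
  have sep': "\<not> reachable V R y x" using sep reachable_sym[of V R y x] by blast
  \<comment> \<open>The component of \<open>y\<close> also has a large odd boundary, so the circuit
    meets it in some \<open>b\<close>. If \<open>y\<close> were in the closure of \<open>x\<close>,
    so would be \<open>b\<close>, and the one-vertex segment \<open>[b]\<close> would be a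
    link.\<close>
  have "y \<notin> closure_layer x"
  proof
    assume "y \<in> closure_layer x"
    then obtain n where n: "y \<in> layer x n" by (auto simp: closure_layer_def)
    obtain b where b: "b \<in> set W0" "b \<in> layer y 0"
    proof -
      have "k < 2 * card (exits closed_walk (layer y 0))"
        by (rule many[OF layer_in_V layer_closed]) (use refl sep' in auto)
      then show ?thesis using meets that by metis
    qed
    then have "b \<in> layer x n" using layer_closed[OF n] by simp
    then show False using nolink[OF single[OF b(1)], of b n b 0] b by simp
  qed
  moreover have "x \<notin> closure_layer y"
  proof
    assume "x \<in> closure_layer y"
    then obtain n where n: "x \<in> layer y n" by (auto simp: closure_layer_def)
    obtain b where b: "b \<in> set W0" "b \<in> layer x 0"
    proof -
      have "k < 2 * card (exits closed_walk (layer x 0))"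
        by (rule many[OF layer_in_V layer_closed]) (use refl sep in auto)
      then show ?thesis using meets that by metis
    qed
    then have "b \<in> layer y n" using layer_closed[OF n] by simp
    then show False using nolink[OF single[OF b(1)], of b 0 b n] b by simp
  qed
  moreover have "x \<in> closure_layer x" "y \<in> closure_layer y"
    using refl unfolding closure_layer_def by blast+
  moreover have cl: "w \<in> closure_layer z" if "v \<in> closure_layer z" "reachable V R v w" for v w z
    using that layer_closed[of v z _ w] by (auto simp: closure_layer_def)
  moreover have "closure_layer z \<subseteq> V" for z using layer_in_V[of z] by (auto simp: closure_layer_def)
  ultimately have "k < 2 * card (exits closed_walk (closure_layer x))"
    "k < 2 * card (exits closed_walk (closure_layer y))"
    using many[of "closure_layer x"] many[of "closure_layer y"] by simp_all
  moreover have "card (exits closed_walk (closure_layer x)) + card (exits closed_walk (closure_layer y)) \<le> card F"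
  proof (rule exit_counts[OF _ F(1)])
    fix s assume "seg s"
    then show "set s \<inter> closure_layer x = {} \<or> set s \<inter> closure_layer y = {}"
      using nolink[of s] unfolding closure_layer_def by auto
  qed
  \<comment> \<open>For \<open>k = 0\<close> each closure has at least one exit, two in all against
    \<open>card F \<le> 1\<close>. For positive \<open>k\<close> twice the total is at least
    \<open>2 * (k + 1)\<close>, against \<open>card F \<le> k\<close>.\<close>
  ultimately show False using F(2) by (cases k) auto
qed

end

section \<open>Opening the circuit at an edge, and the final assembly\<close>

text \<open>The closed list is rotated cyclically so that \<open>f\<close> would be its last step,
  and this step is left out. The \<open>tl\<close> merges the two copies of the old starting
  vertex.\<close>

lemma circuit_open_at_edge:
  assumes H: "circuit V E H" and f: "f \<in> edges_of H"
  obtains W where "trail V E W" "f = {last W, hd W}" "f \<notin> edges_of W"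
    "insert f (edges_of W) = edges_of H" "set W = set H"
proof -
  obtain i where i: "i < length (walk_edges H)" "f = walk_edges H ! i" using f by (metis in_set_conv_nth)
  then have i': "Suc i < length H" unfolding length_walk_edges by linarith
  define X u v Y where "X = take i H" and "u = H ! i" and "v = H ! Suc i" and "Y = drop (Suc (Suc i)) H"
  have fuv: "f = {u, v}" using i(2) nth_walk_edges[OF i'] by (simp add: u_def v_def)
  have Heq: "H = (X @ [u]) @ (v # Y)"
    using i' by (simp add: X_def u_def v_def Y_def Cons_nth_drop_Suc id_take_nth_drop[symmetric])
  define W where "W = (v # Y) @ tl (X @ [u])"
  have weH: "walk_edges H = walk_edges (X @ [u]) @ f # walk_edges (v # Y)"
    unfolding Heq fuv by (subst walk_edges_append) auto
  have closed: "last (v # Y) = hd (X @ [u])"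
    using H unfolding circuit_def Heq by (simp only: last_appendR hd_append snoc_eq_iff_butlast list.distinct) simp
  then have weW: "walk_edges W = walk_edges (v # Y) @ walk_edges (X @ [u])"
    unfolding W_def by (intro walk_edges_join) auto
  have dist: "distinct (walk_edges H)" and VH: "set H \<subseteq> V" and EH: "edges_of H \<subseteq> E"
    using H by (auto simp: circuit_def trail_def walk_def)
  have "hd (X @ [u]) \<in> set (v # Y)" unfolding closed[symmetric] by (rule last_in_set) simp
  moreover have "set (X @ [u]) = insert (hd (X @ [u])) (set (tl (X @ [u])))" by (cases X) auto
  moreover have "set W = set (v # Y) \<union> set (tl (X @ [u]))" by (simp only: W_def set_append)
  moreover have "set H = set (X @ [u]) \<union> set (v # Y)" by (simp only: Heq set_append)
  moreover have "A \<union> T = B \<union> A" if "h \<in> A" "B = insert h T" for h :: 'a and A B T using that by auto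
  ultimately have "set W = set H" by metis
  moreover have "trail V E W"
  proof -
    have "W \<noteq> []" by (simp add: W_def)
    moreover have "distinct (walk_edges W)" "edges_of W \<subseteq> E" using dist EH by (auto simp: weW weH)
    ultimately show ?thesis using VH \<open>set W = set H\<close> by (simp add: trail_def walk_def)
  qed
  moreover have "last W = u" using closed unfolding W_def by (cases X) auto
  then have "f = {last W, hd W}" by (simp add: fuv W_def)
  moreover have "f \<notin> edges_of W" using dist by (auto simp: weW weH)
  moreover have "insert f (edges_of W) = edges_of H" by (auto simp: weW weH)
  ultimately show ?thesis using that by blast
qed

theorem theorem3p1:
  fixes V :: "'a set" and E :: "'a set set" and k :: nat
    and e :: "nat \<Rightarrow> 'a set" and H :: "'a list"
  assumes "finite_simple_graph V E"
    and "\<not> (\<exists>C. odd_cut V E C \<and> card C \<le> k + 1)"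
    and "\<forall>i\<in>{1..k+1}. e i \<in> E"
    and "circuit V E H"
    and "\<forall>i\<in>{1..k}. e i \<in> edges_of H"
    and "bridge V (E - edges_of H) (e (k + 1))"
  shows "(\<exists>H'. circuit V E H' \<and> (\<forall>i\<in>{1..k+1}. e i \<in> edges_of H')) \<and>
    (\<forall>x\<in>e (k + 1). x \<notin> verts_of H \<longrightarrow>
       (\<exists>H'. circuit V E H' \<and> (\<forall>i\<in>{1..k+1}. e i \<in> edges_of H') \<and> passes_exactly_once H' x))"
proof -
  have eE: "e (k + 1) \<in> E" and eH: "e (k + 1) \<notin> edges_of H" using assms(6) by (auto simp: bridge_def)
  then obtain x y where xy: "x \<in> V" "y \<in> V" "x \<noteq> y" "e (k + 1) = {x, y}"
    using assms(1) unfolding finite_simple_graph_def by blast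
  define R where "R = E - edges_of H - {{x, y}}"
  define E' where "E' = E - {{x, y}}"
  have EE': "insert {x, y} E' = E" using eE xy(4) by (auto simp: E'_def)
  have sep: "\<not> reachable V R x y" using bridge_not_reachable assms(6) xy(4) unfolding R_def by metis
  have HE': "circuit V E' H"
    using assms(4) eH xy(4) by (auto simp: circuit_def trail_def walk_def E'_def)
  \<comment> \<open>If the circuit had no edge, the bridge alone would be the boundary of the
    component of \<open>x\<close> in \<open>R\<close>, an odd cut of size one.\<close>
  have "edges_of H \<noteq> {}"
  proof
    assume no: "edges_of H = {}"
    let ?S = "{v. reachable V R x v}"
    have "edge_boundary E ?S = {{x, y}}"
    proof (intro equalityI subsetI)
      fix g assume "g \<in> edge_boundary E ?S"
      then obtain u v where g: "g \<in> E" "g = {u, v}" "reachable V R x u" "\<not> reachable V R x v"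
        by (auto simp: edge_boundary_def)
      have "u \<in> V" "v \<in> V" using assms(1) g by (auto simp: finite_simple_graph_def doubleton_eq_iff)
      then have "g \<notin> R" using reachable_edge[of u v R V] reachable_trans[OF g(3), of v] g(2,4) by blast
      then show "g \<in> {{x, y}}" using g(1) no by (auto simp: R_def)
    next
      fix g assume "g \<in> {{x, y}}"
      then show "g \<in> edge_boundary E ?S"
        using eE xy(4) sep reachable_refl[OF xy(1)] unfolding edge_boundary_def by auto
    qed
    then have "odd_cut V E {{x, y}}"
      unfolding odd_cut_def is_cut_def using reachable_in[of V R x] by (auto intro!: exI[of _ ?S])
    then show False using assms(2) by auto
  qed
  then obtain g where g: "g \<in> edges_of H" by (meson equals0I)
  \<comment> \<open>For \<open>k = 0\<close> an arbitrary edge of \<open>H\<close> serves as the place where the circuit is opened.\<close>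
  define F where "F = (if k = 0 then {g} else e ` {1..k})"
  have F: "finite F" "card F \<le> max 1 k" "F \<subseteq> edges_of H" "\<forall>i\<in>{1..k}. e i \<in> F" "F \<noteq> {}"
    using g assms(5) card_image_le[of "{1..k}" e] by (auto simp: F_def)
  then obtain f where f: "f \<in> F" by blast
  obtain W0 where W0: "trail V E' W0" "f = {last W0, hd W0}" "f \<notin> edges_of W0"
    "insert f (edges_of W0) = edges_of H" "set W0 = set H"
    using circuit_open_at_edge[OF HE' subsetD[OF F(3) f]] .
  interpret closed_trail V E' R F W0 f
  proof
    show "R \<subseteq> E'" by (auto simp: R_def E'_def)
    show "set W0 \<subseteq> V" using W0(1) by (simp add: trail_def walk_def)
    show "f \<in> E'" using W0(4) HE' by (auto simp: circuit_def trail_def walk_def)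
    show "R \<inter> insert f (edges_of W0) = {}" unfolding W0(4) by (auto simp: R_def)
  qed (use W0 f F(3) in auto)
  have new: "{x, y} \<notin> E'" by (simp add: E'_def)
  obtain z a b i j where link: "seg z" "a \<in> set z" "a \<in> layer x i" "b \<in> set z" "b \<in> layer y j"
  proof (rule linking_segment[of x y k])
    show "finite_simple_graph V (insert {x, y} E')" using assms(1) EE' by simp
    show "E' \<subseteq> R \<union> insert f (edges_of W0)" unfolding W0(4) by (auto simp: R_def E'_def)
    show "\<not> (\<exists>C. odd_cut V (insert {x, y} E') C \<and> card C \<le> k + 1)" using assms(2) EE' by simp
  qed (use new sep xy F in auto)
  obtain W where "covers (layer x 0 \<union> layer y 0) W" "hd W \<in> layer x 0" "last W \<in> layer y 0"
    using linked_components[OF link] .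
  \<comment> \<open>One circuit serves both claims: it passes exactly once through each end of the
    bridge that is not on \<open>H\<close>.\<close>
  then obtain H' where H': "circuit V (insert {x, y} E') H'" "insert {x, y} F \<subseteq> edges_of H'"
    "\<And>z. z \<in> {x, y} \<Longrightarrow> z \<notin> set W0 \<Longrightarrow> passes_exactly_once H' z"
    using closing_circuit[OF _ _ _ sep xy(1,2) new] by blast
  have "e i \<in> edges_of H'" if "i \<in> {1..k + 1}" for i
  proof (cases "i = k + 1")
    case False
    then show ?thesis using F(4) H'(2) that by auto
  qed (use H'(2) xy(4) in auto)
  moreover have "circuit V E H'" using H'(1) EE' by simp
  moreover have "passes_exactly_once H' v" if "v \<in> e (k + 1)" "v \<notin> set H" for v
    using H'(3) that xy(4) W0(5) by simp
  ultimately show ?thesis by blast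
qed

end
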